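(* Let $G=(V,E)$ be a finite simple graph with $V=\{1,\dots,n\}$, $n\ge1$, and let $c\in\mathbb{R}$. Let $\mathbf{x}\in\Delta_n$ and let $\mathcal{P}$ be a partition of $\operatorname{supp}(\mathbf{x})$ separating distinct values of $\mathbf{x}$. Let $\mathbb{E}=(V_1,\dots,V_k)$ be an enumeration of $\mathcal{P}$, let $D$ be the edge density matrix associated with $\mathbb{E}$, and set $\Lambda=\operatorname{diag}(|V_1|,\dots,|V_k|)$. If $\mathbf{x}\in\mathrm{gKKT}(c)$, then $\operatorname{bary}_{\mathbb{E}}(\mathbf{x})$ is a KKT point for the program $$\max_{\mathbf{y}\in\operatorname{int}\Delta_k}\ \mathbf{y}^\top(D+c\Lambda^{-1})\mathbf{y}.$$
   Context: Graphs are finite, undirected, unweighted, without loops; $i\sim j$ means $\{i,j\}\in E$. $A$ is the adjacency matrix of $G$, $I$ the identity matrix, $\mathbf 1$ the all-ones vector. $\Delta_m=\{\mathbf{x}\in\mathbb{R}^m:\mathbf{1}^\top\mathbf{x}=1,\ \mathbf{x}\ge\mathbf 0\}$, $\operatorname{int}\Delta_m$ is the set of points of $\Delta_m$ with all coordinates positive, and $\operatorname{supp}(\mathbf{x})=\{i:x_i\ne0\}$. $\mathrm{gKKT}(c)$ is the set of generalized KKT points of $\max_{\mathbf{x}\in\Delta_n}\mathbf{x}^\top(A+cI)\mathbf{x}$: the set of $\mathbf{x}\in\Delta_n$ for which there exist $\mu_0\in\mathbb{R}$, $\boldsymbol\mu\in\mathbb{R}^n$ with $2(A+cI)\mathbf{x}+\mu_0\mathbf{1}+\boldsymbol\mu=\mathbf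 0$ and $\mu_ix_i=0$ for every $i\in V$ (no sign condition on $\boldsymbol\mu$). For a symmetric $M\in\mathbb{R}^{k\times k}$, $\mathbf{y}$ is a KKT point for $\max_{\mathbf{y}\in\operatorname{int}\Delta_k}\mathbf{y}^\top M\mathbf{y}$ if $\mathbf{y}\in\operatorname{int}\Delta_k$ and there exist $\mu_0\in\mathbb{R}$, $\boldsymbol\mu\in\mathbb{R}^k$ with $2M\mathbf{y}+\mu_0\mathbf{1}+\boldsymbol\mu=\mathbf 0$, $\mu_\ell y_\ell=0$ for all $\ell$, and $\boldsymbol\mu\ge\mathbf 0$. A partition $\mathcal{P}$ of $\operatorname{supp}(\mathbf{x})$ separates distinct values of $\mathbf{x}$ if whenever $i,j\in\operatorname{supp}(\mathbf{x})$ and $x_i\ne x_j$, the nodes $i,j$ belong to distinct classes of $\mathcal{P}$. An enumeration of $\mathcal{P}$ is a tuple $(V_1,\dots,V_k)$ of distinct sets with $\mathcal{P}=\{V_1,\dots,V_k\}$. For non-empty $S\subseteq V$, $\mathbf{x}^S\in\Delta_n$ is the characteristic vector: $x^S_i=|S|^{-1}$ if $i\in S$, $0$ otherwise. For a tuple $\mathbb{E}=(V_1,\dots,V_k)$ of non-empty pairwise disjoint subsets of $V$ and $\mathbf{x}\in\operatorname{conv}(\mathbf{x}^{V_1},\dots,\mathbf{x}^{V_k})$, $\operatorname{bary}_{\mathbb{E}}(\mathbf{x})$ is the unique $\mathbf{y}\in\Delta_k$ with $\mathbf{x}=\sum_{\ell=1}^k y_\ell\mathbf{x}^{V_\ell}$.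 (If $\mathbb{E}$ enumerates a partition of $\operatorname{supp}(\mathbf{x})$ separating distinct values of $\mathbf{x}$, then $\mathbf{x}$ lies in this convex hull, so $\operatorname{bary}_{\mathbb{E}}(\mathbf{x})$ is defined.) For non-empty $S_1,S_2\subseteq V$, $e_G(S_1,S_2)=|\{(i,j)\in S_1\times S_2:i\sim j\}|$ and $d_G(S_1,S_2)=e_G(S_1,S_2)/(|S_1||S_2|)$. The edge density matrix associated with $\mathbb{E}$ is the symmetric $k\times k$ matrix with entries $d_G(V_\ell,V_m)$. *)

theory Defs
  imports "HOL-Analysis.Analysis" "HOL-Library.Disjoint_Sets"
begin

text \<open>The vertex set is the whole finite type \<open>'n\<close>, so that \<open>n = CARD('n)\<close>; a graph is given by
  its set of edges, each edge being a two-element set of vertices.\<close>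

definition simple_graph :: "'n::finite set set \<Rightarrow> bool" where
  "simple_graph E \<longleftrightarrow> (\<forall>e\<in>E. card e = 2)"

definition adj :: "'n::finite set set \<Rightarrow> 'n \<Rightarrow> 'n \<Rightarrow> bool" where
  "adj E i j \<longleftrightarrow> {i, j} \<in> E"

definition adjacency_matrix :: "'n::finite set set \<Rightarrow> real^'n^'n" where
  "adjacency_matrix E = (\<chi> i j. if adj E i j then 1 else 0)"

definition std_simplex :: "(real^'m::finite) set" where
  "std_simplex = {x. (\<Sum>i\<in>UNIV. x $ i) = 1 \<and> (\<forall>i. 0 \<le> x $ i)}"

definition int_simplex :: "(real^'m::finite) set" where
  "int_simplex = {x \<in> std_simplex. \<forall>i. 0 < x $ i}"

definition supp :: "real^'m::finite \<Rightarrow> 'm set" where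
  "supp x = {i. x $ i \<noteq> 0}"

definition all_ones :: "real^'m::finite" where
  "all_ones = (\<chi> i. 1)"

definition diag_matrix :: "real^'m::finite \<Rightarrow> real^'m^'m" where
  "diag_matrix d = (\<chi> i j. if i = j then d $ i else 0)"

definition gKKT :: "'n::finite set set \<Rightarrow> real \<Rightarrow> (real^'n) set" where
  "gKKT E c = {x \<in> std_simplex. \<exists>(\<mu>0::real) (\<mu>::real^'n).
     2 *\<^sub>R ((adjacency_matrix E + c *\<^sub>R mat 1) *v x) + \<mu>0 *\<^sub>R all_ones + \<mu> = 0
     \<and> (\<forall>i. \<mu> $ i * x $ i = 0)}"

text \<open>\<open>KKT_int_simplex M y\<close>: \<open>y\<close> is a KKT point for maximising the quadratic form of \<open>M\<close> over the
  interior of the simplex. It is meant for symmetric \<open>M\<close>, where \<open>2 M y\<close> is the gradient of the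
  objective.\<close>

definition KKT_int_simplex :: "real^'k^'k \<Rightarrow> real^'k::finite \<Rightarrow> bool" where
  "KKT_int_simplex M y \<longleftrightarrow> y \<in> int_simplex \<and> (\<exists>(\<mu>0::real) (\<mu>::real^'k).
     2 *\<^sub>R (M *v y) + \<mu>0 *\<^sub>R all_ones + \<mu> = 0
     \<and> (\<forall>l. \<mu> $ l * y $ l = 0) \<and> (\<forall>l. 0 \<le> \<mu> $ l))"

definition separates_values :: "'n::finite set set \<Rightarrow> real^'n \<Rightarrow> bool" where
  "separates_values P x \<longleftrightarrow> (\<forall>i\<in>supp x. \<forall>j\<in>supp x. x $ i \<noteq> x $ j \<longrightarrow>
     (\<forall>S\<in>P. \<forall>T\<in>P. i \<in> S \<longrightarrow> j \<in> T \<longrightarrow> S \<noteq> T))"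

text \<open>A tuple \<open>(V\<^sub>1, \<dots>, V\<^sub>k)\<close> of vertex sets is a family indexed by a finite type \<open>'k\<close> with
  \<open>k = CARD('k)\<close>.\<close>

definition enumerates :: "('k::finite \<Rightarrow> 'n::finite set) \<Rightarrow> 'n set set \<Rightarrow> bool" where
  "enumerates V P \<longleftrightarrow> inj V \<and> range V = P"

definition char_vec :: "'n::finite set \<Rightarrow> real^'n" where
  "char_vec S = (\<chi> i. if i \<in> S then 1 / real (card S) else 0)"

text \<open>Meaningful only if the \<open>V l\<close> are non-empty and pairwise disjoint and \<open>x\<close> is in the convex hull
  of their characteristic vectors; the \<open>y\<close> below is then unique.\<close>

definition bary :: "('k::finite \<Rightarrow> 'n::finite set) \<Rightarrow> real^'n \<Rightarrow> real^'k" where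
  "bary V x = (THE y. y \<in> std_simplex \<and> x = (\<Sum>l\<in>UNIV. (y $ l) *\<^sub>R char_vec (V l)))"

definition edge_count :: "'n::finite set set \<Rightarrow> 'n set \<Rightarrow> 'n set \<Rightarrow> nat" where
  "edge_count E S T = card {(i, j) \<in> S \<times> T. adj E i j}"

definition edge_density :: "'n::finite set set \<Rightarrow> 'n set \<Rightarrow> 'n set \<Rightarrow> real" where
  "edge_density E S T = real (edge_count E S T) / (real (card S) * real (card T))"

definition edge_density_matrix ::
  "'n::finite set set \<Rightarrow> ('k::finite \<Rightarrow> 'n set) \<Rightarrow> real^'k^'k" where
  "edge_density_matrix E V = (\<chi> l m. edge_density E (V l) (V m))"

end

theory Submission
  imports Defs
begin

text \<open>Write \<open>M = A + c I\<close>. The entries of \<open>D + c \<Lambda>\<inverse>\<close> are the values of the bilinear form of \<open>M\<close> on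
  the characteristic vectors of the classes, so if \<open>x\<close> is the combination of these vectors with
  coefficients \<open>y\<close>, then \<open>(D + c \<Lambda>\<inverse>) y\<close> consists of the averages of \<open>M x\<close> over the classes. On the
  support of \<open>x\<close> the vector \<open>M x\<close> is constant, so these averages all coincide and the conditions
  hold with zero multipliers for the sign constraints.\<close>

lemma inner_char_vec: "char_vec S \<bullet> z = (\<Sum>i\<in>S. z $ i) / real (card S)"
proof -
  have "char_vec S \<bullet> z = (\<Sum>i\<in>UNIV. if i \<in> S then z $ i / real (card S) else 0)"
    unfolding inner_vec_def char_vec_def by (intro sum.cong) auto
  also have "\<dots> = (\<Sum>i\<in>S. z $ i / real (card S))"
    by (simp add: sum.If_cases)
  finally show ?thesis
    by (simp add: sum_divide_distrib)
qed

lemma sum_char_vec: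
  assumes "S \<noteq> {}"
  shows "(\<Sum>i\<in>UNIV. char_vec S $ i) = 1"
  using assms inner_char_vec[of S all_ones]
  by (simp add: inner_vec_def all_ones_def)

text \<open>Disjoint supports make the vectors orthogonal. The squared norms
  \<open>1 / real (card (V l))\<close> are what turns the term \<open>c I\<close> into
  \<open>c\<close> times the inverse of \<Lambda>; orthogonality also makes barycentric coordinates
  unique.\<close>

lemma inner_char_vec_char_vec:
  assumes "disjoint_family V"
  shows "char_vec (V l) \<bullet> char_vec (V m) = (if l = m then 1 / real (card (V l)) else 0)"
proof (cases "l = m")
  case True
  have "(\<Sum>i\<in>V m. char_vec (V m) $ i) / real (card (V m)) = 1 / real (card (V m))"
    by (simp add: char_vec_def)
  then show ?thesis
    using True by (simp add: inner_char_vec)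
next
  case False
  then have "V l \<inter> V m = {}"
    using assms by (auto simp: disjoint_family_on_def)
  then have "(\<Sum>i\<in>V l. char_vec (V m) $ i) = 0"
    by (intro sum.neutral) (auto simp: char_vec_def)
  then show ?thesis
    using False by (simp add: inner_char_vec)
qed

text \<open>Entry \<open>i\<close> of the matrix-vector product is the fraction of \<open>T\<close>
  adjacent to \<open>i\<close>. Averaging this over \<open>S\<close> counts the edge pairs grouped
  by their first endpoint.\<close>

lemma edge_density_eq_inner:
  "edge_density E S T = char_vec S \<bullet> (adjacency_matrix E *v char_vec T)"
proof -
  have row: "(adjacency_matrix E *v char_vec T) $ i = real (card {j \<in> T. adj E i j}) / real (card T)"
    for i
  proof -
    have "(adjacency_matrix E *v char_vec T) $ i = char_vec T \<bullet> (adjacency_matrix E $ i)"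
      by (simp add: matrix_vector_mult_def inner_vec_def mult.commute)
    also have "\<dots> = (\<Sum>j\<in>T. if adj E i j then 1 else 0) / real (card T)"
      by (simp add: inner_char_vec adjacency_matrix_def)
    also have "(\<Sum>j\<in>T. if adj E i j then 1 else 0 :: real) = real (card {j \<in> T. adj E i j})"
      by (simp add: sum.If_cases Int_def)
    finally show ?thesis .
  qed
  have "{(i, j) \<in> S \<times> T. adj E i j} = (SIGMA i:S. {j \<in> T. adj E i j})"
    by auto
  then have "edge_count E S T = (\<Sum>i\<in>S. card {j \<in> T. adj E i j})"
    unfolding edge_count_def by simp
  then show ?thesis
    by (simp add: edge_density_def inner_char_vec row flip: sum_divide_distrib)
qed

text \<open>\<open>matrix_inv\<close> is defined by choice, so the reciprocal diagonal matrix is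
  first checked to be a two-sided inverse; uniqueness of inverses then identifies the chosen one
  with it.\<close>

lemma matrix_inv_diag_matrix:
  fixes d :: "real^'a::finite"
  assumes "\<And>i. d $ i \<noteq> 0"
  shows "matrix_inv (diag_matrix d) = diag_matrix (\<chi> i. 1 / d $ i)"
proof -
  let ?A = "diag_matrix d" and ?B = "diag_matrix (\<chi> i. 1 / d $ i)"
  have mult: "diag_matrix a ** diag_matrix b = diag_matrix (\<chi> i. a $ i * b $ i)" for a b :: "real^'a"
  proof -
    have "(\<Sum>k\<in>UNIV. diag_matrix a $ i $ k * diag_matrix b $ k $ j)
        = (\<Sum>k\<in>{i}. diag_matrix a $ i $ k * diag_matrix b $ k $ j)" for i j
      by (rule sum.mono_neutral_right) (auto simp: diag_matrix_def)
    then show ?thesis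
      by (simp add: vec_eq_iff matrix_matrix_mult_def) (simp add: diag_matrix_def)
  qed
  have AB: "?A ** ?B = mat 1" and BA: "?B ** ?A = mat 1"
    using assms by (simp_all add: mult) (simp_all add: diag_matrix_def mat_def vec_eq_iff)
  have "matrix_inv ?A ** ?A = mat 1"
    \<comment> \<open>The explicit inverse witnesses that the choice is not vacuous.\<close>
    unfolding matrix_inv_def using conjI[OF AB BA] by (rule someI2) (rule conjunct2)
  have "matrix_inv ?A = matrix_inv ?A ** (?A ** ?B)"
    by (simp only: AB matrix_mul_rid)
  also have "\<dots> = matrix_inv ?A ** ?A ** ?B"
    by (rule matrix_mul_assoc)
  also have "\<dots> = ?B"
    by (simp only: \<open>matrix_inv ?A ** ?A = mat 1\<close> matrix_mul_lid)
  finally show ?thesis .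
qed

text \<open>Both sides are linear in \<open>y\<close>, so it suffices to compare matrix entries: the
  density part comes from the adjacency matrix, the diagonal part from orthogonality of the
  characteristic vectors.\<close>

lemma quotient_matrix_mult_vec:
  fixes V :: "'k::finite \<Rightarrow> 'n::finite set" and y :: "real^'k"
  assumes disj: "disjoint_family V" and ne: "\<And>l. V l \<noteq> {}"
  shows "((edge_density_matrix E V
      + c *\<^sub>R matrix_inv (diag_matrix (\<chi> l. real (card (V l))))) *v y) $ l
    = char_vec (V l) \<bullet>
      ((adjacency_matrix E + c *\<^sub>R mat 1) *v (\<Sum>m\<in>UNIV. (y $ m) *\<^sub>R char_vec (V m)))"
proof -
  let ?A = "adjacency_matrix E"
  let ?M = "?A + c *\<^sub>R mat 1"
  let ?Q = "edge_density_matrix E V + c *\<^sub>R matrix_inv (diag_matrix (\<chi> l. real (card (V l))))"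
  have M: "?M *v z = ?A *v z + c *\<^sub>R z" for z
    by (simp add: matrix_vector_mult_add_rdistrib flip: scaleR_matrix_vector_assoc)
  have inv: "matrix_inv (diag_matrix (\<chi> l. real (card (V l))))
      = (diag_matrix (\<chi> l. 1 / real (card (V l))) :: real^'k^'k)"
    using ne by (subst matrix_inv_diag_matrix) auto
  have Q: "?Q $ l $ m = char_vec (V l) \<bullet> (?M *v char_vec (V m))" for m
    unfolding inv by (simp add: M inner_add_right inner_char_vec_char_vec[OF disj]
        edge_density_matrix_def edge_density_eq_inner diag_matrix_def)
  have "(?Q *v y) $ l = (\<Sum>m\<in>UNIV. y $ m * (char_vec (V l) \<bullet> (?M *v char_vec (V m))))"
    unfolding matrix_vector_mult_def[of ?Q] by (simp only: vec_lambda_beta Q mult.commute)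
  also have "\<dots> = char_vec (V l) \<bullet> (?M *v (\<Sum>m\<in>UNIV. (y $ m) *\<^sub>R char_vec (V m)))"
    by (simp add: linear_sum[OF matrix_vector_mul_linear] inner_sum_right
        matrix_vector_mult_scaleR)
  finally show ?thesis .
qed

text \<open>Pairing a combination with \<open>char_vec (V l)\<close> isolates its coefficient at
  \<open>l\<close>, scaled by the nonzero factor \<open>1 / real (card (V l))\<close>. Hence the
  coefficients are determined by \<open>x\<close>, and the definite description picks out
  \<open>y\<close>.\<close>

lemma bary_eqI:
  fixes V :: "'k::finite \<Rightarrow> 'n::finite set"
  assumes disj: "disjoint_family V" and ne: "\<And>l. V l \<noteq> {}"
    and y: "y \<in> std_simplex" and x: "x = (\<Sum>l\<in>UNIV. (y $ l) *\<^sub>R char_vec (V l))"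
  shows "bary V x = y"
proof -
  have coeff: "char_vec (V l) \<bullet> (\<Sum>m\<in>UNIV. (z $ m) *\<^sub>R char_vec (V m)) = z $ l / real (card (V l))"
    for z :: "real^'k" and l
    by (simp add: inner_sum_right inner_char_vec_char_vec[OF disj]
        if_distrib[of "\<lambda>t. _ * t"] cong: if_cong)
  have unique: "z = y" if z: "x = (\<Sum>l\<in>UNIV. (z $ l) *\<^sub>R char_vec (V l))" for z :: "real^'k"
  proof -
    have eq: "z $ l / real (card (V l)) = y $ l / real (card (V l))" for l
      using coeff[of l z] coeff[of l y] by (simp only: x[symmetric] z[symmetric])
    have "z $ l = y $ l" for l
      using eq[of l] ne[of l] by (simp add: card_eq_0_iff)
    then show ?thesis
      by (simp add: vec_eq_iff)
  qed
  show ?thesis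
    unfolding bary_def
  proof (rule the_equality)
    show "y \<in> std_simplex \<and> x = (\<Sum>l\<in>UNIV. (y $ l) *\<^sub>R char_vec (V l))"
      using y x by (rule conjI)
  qed (rule unique, rule conjunct2)
qed

text \<open>At a point of \<open>V l\<close> only the summand of that class survives, and it is the
  average of \<open>x\<close> over the class, which is the common value there. Off the support
  everything vanishes.\<close>

lemma constant_on_classes_decomposition:
  fixes V :: "'k::finite \<Rightarrow> 'n::finite set"
  assumes disj: "disjoint_family V" and cover: "(\<Union>l. V l) = supp x"
    and const: "\<And>l i j. i \<in> V l \<Longrightarrow> j \<in> V l \<Longrightarrow> x $ i = x $ j"
  shows "x = (\<Sum>l\<in>UNIV. (\<Sum>i\<in>V l. x $ i) *\<^sub>R char_vec (V l))"
proof -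
  have "(\<Sum>l\<in>UNIV. (\<Sum>j\<in>V l. x $ j) * char_vec (V l) $ i) = x $ i" for i
  proof (cases "i \<in> supp x")
    case True
    then obtain l where l: "i \<in> V l"
      using cover by blast
    have other: "char_vec (V m) $ i = 0" if "m \<noteq> l" for m
      using disj l that by (auto simp: char_vec_def disjoint_family_on_def)
    have "(\<Sum>m\<in>UNIV. (\<Sum>j\<in>V m. x $ j) * char_vec (V m) $ i)
        = (\<Sum>m\<in>{l}. (\<Sum>j\<in>V m. x $ j) * char_vec (V m) $ i)"
      by (rule sum.mono_neutral_right) (auto simp: other)
    also have "\<dots> = (\<Sum>j\<in>V l. x $ j) / real (card (V l))"
      using l by (simp add: char_vec_def)
    also have "(\<Sum>j\<in>V l. x $ j) = (\<Sum>j\<in>V l. x $ i)"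
      by (intro sum.cong refl const[OF _ l])
    also have "\<dots> / real (card (V l)) = x $ i"
      using l by (auto simp: card_eq_0_iff)
    finally show ?thesis .
  next
    case False
    then have "char_vec (V l) $ i = 0" for l
      using cover by (auto simp: char_vec_def)
    then show ?thesis
      using False by (simp add: supp_def)
  qed
  then show ?thesis
    by (simp add: vec_eq_iff)
qed

theorem theorem3:
  fixes E :: "'n::finite set set"
    and c :: real
    and x :: "real^'n"
    and P :: "'n set set"
    and V :: "'k::finite \<Rightarrow> 'n set"
    and D \<Lambda> :: "real^'k^'k"
  assumes "simple_graph E"
    and "x \<in> std_simplex"
    and "partition_on (supp x) P"
    and "separates_values P x"
    and "enumerates V P"
    and "D = edge_density_matrix E V"
    and "\<Lambda> = diag_matrix (\<chi> l. real (card (V l)))"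
    and "x \<in> gKKT E c"
  shows "KKT_int_simplex (D + c *\<^sub>R matrix_inv \<Lambda>) (bary V x)"
proof -
  have P: "range V = P" and "inj V"
    using assms(5) by (auto simp: enumerates_def)
  have ne: "V l \<noteq> {}" for l
    using partition_onD3[OF assms(3)] P by (auto simp: image_iff)
  have cover: "(\<Union>l. V l) = supp x"
    using partition_onD1[OF assms(3)] P by simp
  have disj: "disjoint_family V"
    using partition_onD2[OF assms(3)] \<open>inj V\<close> P
    by (intro disjoint_image_disjoint_family_on) auto
  \<comment> \<open>Contrapositive of the separation property, with both classes taken to be
    \<open>V l\<close>.\<close>
  have const: "x $ i = x $ j" if "i \<in> V l" "j \<in> V l" for l i j
    using assms(4) that cover P unfolding separates_values_def by blast
  have pos: "0 < x $ i" if "i \<in> V l" for i l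
    using that cover assms(2) by (force simp: supp_def std_simplex_def less_le)
  \<comment> \<open>The barycentric coordinates are the masses that \<open>x\<close> puts on the
    classes. They are positive because each class is a non-empty subset of the support.\<close>
  define y :: "real^'k" where "y = (\<chi> l. \<Sum>i\<in>V l. x $ i)"
  have x: "x = (\<Sum>l\<in>UNIV. (y $ l) *\<^sub>R char_vec (V l))"
    using constant_on_classes_decomposition[OF disj cover const] by (simp add: y_def)
  have y_pos: "0 < y $ l" for l
    using ne pos by (auto simp: y_def intro!: sum_pos)
  have "1 = (\<Sum>i\<in>UNIV. x $ i)"
    using assms(2) by (simp add: std_simplex_def)
  also have "\<dots> = (\<Sum>i\<in>UNIV. \<Sum>l\<in>UNIV. y $ l * char_vec (V l) $ i)"
    by (subst x) simp
  also have "\<dots> = (\<Sum>l\<in>UNIV. y $ l * (\<Sum>i\<in>UNIV. char_vec (V l) $ i))"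
    by (subst sum.swap) (simp add: sum_distrib_left)
  also have "\<dots> = (\<Sum>l\<in>UNIV. y $ l)"
    by (simp add: sum_char_vec ne)
  finally have y_int: "y \<in> int_simplex"
    using y_pos by (simp add: int_simplex_def std_simplex_def less_imp_le)
  then have bary: "bary V x = y"
    by (intro bary_eqI[OF disj ne _ x]) (auto simp: int_simplex_def)

  obtain \<mu>0 \<mu> where kkt: "2 *\<^sub>R ((adjacency_matrix E + c *\<^sub>R mat 1) *v x) + \<mu>0 *\<^sub>R all_ones + \<mu> = 0"
    and compl: "\<And>i. \<mu> $ i * x $ i = 0"
    using assms(8) by (auto simp: gKKT_def)
  have Mx: "((adjacency_matrix E + c *\<^sub>R mat 1) *v x) $ i = - \<mu>0 / 2" if "i \<in> V l" for i l
  proof -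
    \<comment> \<open>Complementarity removes the multiplier on the support whatever its sign, so
      the absence of a sign condition in \<open>gKKT\<close> does no harm.\<close>
    have "\<mu> $ i = 0"
      using compl[of i] pos[OF that] by simp
    then show ?thesis
      using arg_cong[OF kkt, of "\<lambda>v. v $ i"] by (simp add: all_ones_def)
  qed
  have "((D + c *\<^sub>R matrix_inv \<Lambda>) *v y) $ l = - \<mu>0 / 2" for l
  proof -
    have "((D + c *\<^sub>R matrix_inv \<Lambda>) *v y) $ l
        = char_vec (V l) \<bullet> ((adjacency_matrix E + c *\<^sub>R mat 1) *v x)"
      unfolding assms(6,7) by (subst x) (rule quotient_matrix_mult_vec[OF disj ne])
    also have "\<dots> = (\<Sum>i\<in>V l. - \<mu>0 / 2) / real (card (V l))"
      unfolding inner_char_vec using Mx by (simp cong: sum.cong)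
    also have "\<dots> = - \<mu>0 / 2"
      using ne by simp
    finally show ?thesis .
  qed
  \<comment> \<open>The same \<open>\<mu>0\<close> serves for the quotient program; the zero vector
    as the other multiplier satisfies complementarity and the sign condition at once.\<close>
  then have "2 *\<^sub>R ((D + c *\<^sub>R matrix_inv \<Lambda>) *v y) + \<mu>0 *\<^sub>R all_ones + 0 = 0"
    by (simp add: vec_eq_iff all_ones_def)
  then show ?thesis
    unfolding KKT_int_simplex_def bary using y_int
    by (intro conjI exI[of _ \<mu>0] exI[of _ 0]) auto
qed

end
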